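(* Let $\Gamma$ be a finite oriented simplicial complex on $n$ vertices, let $k\ge 1$, and let $G(S_k)$ be its $k$-simplex graph. Then: (a) For every $k$-simplex $\sigma\in S_k$, the $1$-norm of the $\sigma$ column of $H=I-\frac{1}{n}\Delta_k$ is $$\|H|\sigma\rangle\|_1 = 1+\frac{1}{n}\big(\deg(\sigma)-d_{\mathrm{up}}(\sigma)-k-1\big).$$ (b) The transition probabilities $P_{\sigma\tau}=\frac{|\langle\tau|H|\sigma\rangle|}{\|H|\sigma\rangle\|_1}$ are $$P_{\sigma\tau}=\begin{cases}\frac{1}{n+\deg(\sigma)-d_{\mathrm{up}}(\sigma)-k-1} & \sigma,\tau \text{ adjacent in } G(S_k),\\[2pt] \frac{n-d_{\mathrm{up}}(\sigma)-k-1}{n+\deg(\sigma)-d_{\mathrm{up}}(\sigma)-k-1} & \sigma=\tau,\\[2pt] 0 & \text{otherwise.}\end{cases}$$ (c) The maximum degree of a vertex of $G(S_k)$ is at most $(n-k-1)(k+1)$. If $\Gamma$ is the clique complex of a graph, then the maximum degree is at most $n-k-1$.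
   Context: A simplicial complex $\Gamma$ on vertex set $\{x_1,\dots,x_n\}$ is a family of subsets closed under taking subsets; its elements of size $k+1$ are $k$-simplices, and $S_k$ denotes the set of $k$-simplices. It is oriented via the order $x_1<\dots<x_n$. The boundary map $\partial_k:\mathbb{C}S_k\to\mathbb{C}S_{k-1}$ sends $|\{x_{i_0},\dots,x_{i_k}\}\rangle$ ($i_0<\dots<i_k$) to $\sum_{j=0}^k(-1)^{j+1}|\{x_{i_0},\dots,x_{i_k}\}\setminus\{x_{i_j}\}\rangle$. $\Delta_k$ is the matrix of $\partial_k^\dagger\partial_k+\partial_{k+1}\partial_{k+1}^\dagger$ in the basis $\{|\sigma\rangle:\sigma\in S_k\}$, and $H=I-\frac1n\Delta_k$. The up-degree $d_{\mathrm{up}}(\sigma)$ of $\sigma\in S_k$ is the number of $(k+1)$-simplices containing $\sigma$. The $k$-simplex graph $G(S_k)$ has vertex set $S_k$, with $\sigma\neq\tau$ adjacent iff $|\sigma\cap\tau|=k$ and $\sigma\cup\tau\notin\Gamma$; $\deg(\sigma)$ is the degree of $\sigma$ in this graph. $\|H|\sigma\rangle\|_1=\sum_{\tau\in S_k}|H_{\tau\sigma}|$. The clique complex of a graph $G$ is the simplicial complex whose simplices are the vertex sets of complete subgraphs of $G$. *)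

theory Defs
  imports Complex_Main "HOL-Library.Ramsey"
begin

text \<open>The vertices \<open>x\<^sub>1 < \<dots> < x\<^sub>n\<close> are the elements of a finite set in a linearly ordered type.
  Not every element of \<open>V\<close> has to be a \<open>0\<close>-simplex.\<close>

definition simplicial_complex :: "'a set \<Rightarrow> 'a set set \<Rightarrow> bool" where
  "simplicial_complex V \<Gamma> \<longleftrightarrow>
     finite V \<and> \<Gamma> \<subseteq> Pow V \<and> (\<forall>\<sigma>\<in>\<Gamma>. \<forall>\<tau>. \<tau> \<subseteq> \<sigma> \<longrightarrow> \<tau> \<in> \<Gamma>)"

definition simplices :: "'a set set \<Rightarrow> nat \<Rightarrow> 'a set set" where
  "simplices \<Gamma> k = {\<sigma> \<in> \<Gamma>. card \<sigma> = k + 1}"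

text \<open>A vector of \<open>\<complex>S\<^sub>k\<close> is given by its coordinates in the basis of \<open>k\<close>-simplices: it is a
  function that vanishes outside \<open>simplices \<Gamma> k\<close>.\<close>

type_synonym 'a chain = "'a set \<Rightarrow> complex"

definition ket :: "'a set \<Rightarrow> 'a chain" where
  "ket \<sigma> = (\<lambda>\<tau>. if \<tau> = \<sigma> then 1 else 0)"

definition inner_on :: "'a set set \<Rightarrow> 'a chain \<Rightarrow> 'a chain \<Rightarrow> complex" where
  "inner_on A f g = (\<Sum>\<sigma>\<in>A. cnj (f \<sigma>) * g \<sigma>)"

definition boundary_ket :: "nat \<Rightarrow> 'a::linorder set \<Rightarrow> 'a chain" where
  "boundary_ket k \<sigma> =
     (\<lambda>\<rho>. \<Sum>j=0..k. (-1) ^ (j + 1) * ket (\<sigma> - {sorted_list_of_set \<sigma> ! j}) \<rho>)"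

definition boundary :: "'a::linorder set set \<Rightarrow> nat \<Rightarrow> 'a chain \<Rightarrow> 'a chain" where
  "boundary \<Gamma> k f = (\<lambda>\<rho>. \<Sum>\<sigma>\<in>simplices \<Gamma> k. f \<sigma> * boundary_ket k \<sigma> \<rho>)"

text \<open>The adjoint of a linear map \<open>T : \<complex>A \<rightarrow> \<complex>B\<close>, for finite \<open>A\<close> and \<open>B\<close>, given by the conjugate
  transpose of its matrix; see \<open>adjoint_on_boundary\<close> below for its defining property.\<close>

definition adjoint_on ::
    "'a set set \<Rightarrow> 'a set set \<Rightarrow> ('a chain \<Rightarrow> 'a chain) \<Rightarrow> 'a chain \<Rightarrow> 'a chain" where
  "adjoint_on A B T g = (\<lambda>\<sigma>. if \<sigma> \<in> A then \<Sum>\<rho>\<in>B. cnj (T (ket \<sigma>) \<rho>) * g \<rho> else 0)"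

definition coboundary :: "'a::linorder set set \<Rightarrow> nat \<Rightarrow> 'a chain \<Rightarrow> 'a chain" where
  "coboundary \<Gamma> k = adjoint_on (simplices \<Gamma> k) (simplices \<Gamma> (k - 1)) (boundary \<Gamma> k)"

text \<open>Because of the truncated \<open>k - 1\<close>, \<open>coboundary\<close> and \<open>laplacian\<close> are only meant for
  \<open>k \<ge> 1\<close>.\<close>

definition laplacian :: "'a::linorder set set \<Rightarrow> nat \<Rightarrow> 'a chain \<Rightarrow> 'a chain" where
  "laplacian \<Gamma> k f =
     (\<lambda>\<tau>. coboundary \<Gamma> k (boundary \<Gamma> k f) \<tau> + boundary \<Gamma> (k + 1) (coboundary \<Gamma> (k + 1) f) \<tau>)"

text \<open>Matrices have the row index first: \<open>laplacian_mat \<Gamma> k \<tau> \<sigma>\<close> is \<open>\<langle>\<tau>|\<Delta>\<^sub>k|\<sigma>\<rangle>\<close>.\<close>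

definition laplacian_mat :: "'a::linorder set set \<Rightarrow> nat \<Rightarrow> 'a set \<Rightarrow> 'a set \<Rightarrow> complex" where
  "laplacian_mat \<Gamma> k \<tau> \<sigma> = laplacian \<Gamma> k (ket \<sigma>) \<tau>"

definition H_mat :: "nat \<Rightarrow> 'a::linorder set set \<Rightarrow> nat \<Rightarrow> 'a set \<Rightarrow> 'a set \<Rightarrow> complex" where
  "H_mat n \<Gamma> k \<tau> \<sigma> = (if \<tau> = \<sigma> then 1 else 0) - 1 / of_nat n * laplacian_mat \<Gamma> k \<tau> \<sigma>"

definition H_col_norm :: "nat \<Rightarrow> 'a::linorder set set \<Rightarrow> nat \<Rightarrow> 'a set \<Rightarrow> real" where
  "H_col_norm n \<Gamma> k \<sigma> = (\<Sum>\<tau>\<in>simplices \<Gamma> k. cmod (H_mat n \<Gamma> k \<tau> \<sigma>))"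

definition transition_prob ::
    "nat \<Rightarrow> 'a::linorder set set \<Rightarrow> nat \<Rightarrow> 'a set \<Rightarrow> 'a set \<Rightarrow> real" where
  "transition_prob n \<Gamma> k \<sigma> \<tau> = cmod (H_mat n \<Gamma> k \<tau> \<sigma>) / H_col_norm n \<Gamma> k \<sigma>"

definition up_degree :: "'a set set \<Rightarrow> nat \<Rightarrow> 'a set \<Rightarrow> nat" where
  "up_degree \<Gamma> k \<sigma> = card {\<rho> \<in> simplices \<Gamma> (k + 1). \<sigma> \<subseteq> \<rho>}"

definition simplex_adj :: "'a set set \<Rightarrow> nat \<Rightarrow> 'a set \<Rightarrow> 'a set \<Rightarrow> bool" where
  "simplex_adj \<Gamma> k \<sigma> \<tau> \<longleftrightarrow>
     \<sigma> \<in> simplices \<Gamma> k \<and> \<tau> \<in> simplices \<Gamma> k \<and> \<sigma> \<noteq> \<tau> \<and> card (\<sigma> \<inter> \<tau>) = k \<and> \<sigma> \<union> \<tau> \<notin> \<Gamma>"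

definition simplex_degree :: "'a set set \<Rightarrow> nat \<Rightarrow> 'a set \<Rightarrow> nat" where
  "simplex_degree \<Gamma> k \<sigma> = card {\<tau> \<in> simplices \<Gamma> k. simplex_adj \<Gamma> k \<sigma> \<tau>}"

definition max_simplex_degree :: "'a set set \<Rightarrow> nat \<Rightarrow> nat" where
  "max_simplex_degree \<Gamma> k = Max (simplex_degree \<Gamma> k ` simplices \<Gamma> k)"

definition simple_graph :: "'a set \<Rightarrow> 'a set set \<Rightarrow> bool" where
  "simple_graph W E \<longleftrightarrow> E \<subseteq> [W]\<^bsup>2\<^esup>"

definition clique_complex :: "'a set \<Rightarrow> 'a set set \<Rightarrow> 'a set set" where
  "clique_complex W E = {C. C \<subseteq> W \<and> clique C E}"

lemma boundary_ket_basis: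
  assumes "finite (simplices \<Gamma> k)" and "\<sigma> \<in> simplices \<Gamma> k"
  shows "boundary \<Gamma> k (ket \<sigma>) = boundary_ket k \<sigma>"
proof
  fix \<rho>
  have "boundary \<Gamma> k (ket \<sigma>) \<rho> =
      (\<Sum>\<tau>\<in>simplices \<Gamma> k. if \<tau> = \<sigma> then boundary_ket k \<tau> \<rho> else 0)"
    unfolding boundary_def ket_def by (intro sum.cong) auto
  then show "boundary \<Gamma> k (ket \<sigma>) \<rho> = boundary_ket k \<sigma> \<rho>"
    using assms by simp
qed

lemma adjoint_on_boundary:
  assumes "finite (simplices \<Gamma> k)"
  shows "inner_on B (boundary \<Gamma> k f) g =
    inner_on (simplices \<Gamma> k) f (adjoint_on (simplices \<Gamma> k) B (boundary \<Gamma> k) g)"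
proof -
  have "inner_on B (boundary \<Gamma> k f) g =
      (\<Sum>\<rho>\<in>B. \<Sum>\<sigma>\<in>simplices \<Gamma> k. cnj (f \<sigma>) * (cnj (boundary_ket k \<sigma> \<rho>) * g \<rho>))"
    by (simp add: inner_on_def boundary_def sum_distrib_right mult.assoc)
  also have "\<dots> =
      (\<Sum>\<sigma>\<in>simplices \<Gamma> k. \<Sum>\<rho>\<in>B. cnj (f \<sigma>) * (cnj (boundary_ket k \<sigma> \<rho>) * g \<rho>))"
    by (rule sum.swap)
  also have "\<dots> =
      inner_on (simplices \<Gamma> k) f (adjoint_on (simplices \<Gamma> k) B (boundary \<Gamma> k) g)"
    unfolding inner_on_def adjoint_on_def
    by (intro sum.cong) (simp_all add: boundary_ket_basis[OF assms] sum_distrib_left)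
  finally show ?thesis .
qed

end

theory Submission
  imports Defs
begin

text \<open>Deleting \<open>x\<close> from \<open>\<sigma>\<close> contributes to the boundary the sign determined by the number of
  vertices of \<open>\<sigma>\<close> below \<open>x\<close>. Two distinct \<open>k\<close>-simplices \<open>\<sigma>\<close>, \<open>\<tau>\<close> interact in \<open>\<Delta>\<^sub>k\<close> only when
  \<open>\<sigma> = \<rho> \<union> {u}\<close> and \<open>\<tau> = \<rho> \<union> {v}\<close>. Then \<open>\<partial>\<^sub>k\<^sup>\<dagger>\<partial>\<^sub>k\<close> contributes a single sign through the common
  face \<open>\<rho>\<close>, and \<open>\<partial>\<^sub>k\<^sub>+\<^sub>1\<partial>\<^sub>k\<^sub>+\<^sub>1\<^sup>\<dagger>\<close> contributes the opposite sign precisely when \<open>\<rho> \<union> {u, v}\<close> is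
  a simplex. So the off-diagonal entries are \<open>\<plusminus>1\<close> on edges of the simplex graph and \<open>0\<close>
  elsewhere, while the diagonal entries are \<open>k + 1 + d\<^sub>u\<^sub>p(\<sigma>) \<le> n\<close>. In a clique complex, \<open>v\<close>
  determines \<open>u\<close> for every neighbour of \<open>\<sigma>\<close>: \<open>u\<close> is the only vertex of \<open>\<sigma>\<close> not joined to \<open>v\<close>.\<close>

section \<open>Signs and coefficients of the boundary of a single simplex\<close>

definition vertex_sign :: "'a::linorder set \<Rightarrow> 'a \<Rightarrow> complex" where
  "vertex_sign \<sigma> x = (-1) ^ (card {y \<in> \<sigma>. y < x} + 1)"

lemma cnj_vertex_sign [simp]: "cnj (vertex_sign \<sigma> x) = vertex_sign \<sigma> x"
  by (simp add: vertex_sign_def)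

lemma cmod_vertex_sign [simp]: "cmod (vertex_sign \<sigma> x) = 1"
  by (simp add: vertex_sign_def norm_power)

lemma vertex_sign_square [simp]: "vertex_sign \<sigma> x * vertex_sign \<sigma> x = 1"
  by (simp add: vertex_sign_def flip: power_mult_distrib)

text \<open>In a strictly increasing list the entries below the one at index j are exactly those at
  the first j indices. This replaces list positions, counted from 0 in \<open>boundary_ket\<close>,
  by a count that can be compared between different simplices containing the same vertex.\<close>

lemma card_less_nth_sorted_list_of_set:
  fixes \<sigma> :: "'a::linorder set"
  assumes "finite \<sigma>" and "j < card \<sigma>"
  shows "card {y \<in> \<sigma>. y < sorted_list_of_set \<sigma> ! j} = j"
proof -
  let ?xs = "sorted_list_of_set \<sigma>"
  have sorted: "sorted_wrt (<) ?xs" by simp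
  have mono: "?xs ! i < ?xs ! l" if "i < l" "l < card \<sigma>" for i l
    using sorted_wrt_nth_less[OF sorted that(1)] that(2) by simp
  have "{y \<in> \<sigma>. y < ?xs ! j} = (!) ?xs ` {..<j}"
  proof (intro equalityI subsetI)
    fix y assume y: "y \<in> {y \<in> \<sigma>. y < ?xs ! j}"
    then obtain i where i: "i < card \<sigma>" "y = ?xs ! i"
      using assms(1) by (metis (no_types, lifting) in_set_conv_nth mem_Collect_eq
          set_sorted_list_of_set sorted_list_of_set.length_sorted_key_list_of_set)
    have "i < j"
    proof (rule ccontr)
      assume "\<not> i < j"
      then have "i = j \<or> j < i" by auto
      then show False using y i mono[of j i] by auto
    qed
    then show "y \<in> (!) ?xs ` {..<j}" using i by blast
  next
    fix y assume "y \<in> (!) ?xs ` {..<j}"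
    then obtain i where i: "i < j" "y = ?xs ! i" by blast
    then have "y \<in> set ?xs" using assms(2) by (simp del: set_sorted_list_of_set)
    then show "y \<in> {y \<in> \<sigma>. y < ?xs ! j}" using assms i mono by auto
  qed
  moreover have "inj_on ((!) ?xs) {..<j}"
    using assms by (intro inj_on_nth) auto
  ultimately show ?thesis by (simp add: card_image)
qed

text \<open>Indexing by vertices is what allows faces to be handled as sets: distinct vertices give
  distinct faces, so every coefficient is either one sign or 0.\<close>

lemma boundary_ket_eq_sum_vertices:
  assumes "finite \<sigma>" and "card \<sigma> = k + 1"
  shows "boundary_ket k \<sigma> \<rho> = (\<Sum>x\<in>\<sigma>. vertex_sign \<sigma> x * ket (\<sigma> - {x}) \<rho>)"
proof -
  let ?xs = "sorted_list_of_set \<sigma>"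
  have bij: "bij_betw ((!) ?xs) {0..k} \<sigma>"
    by (rule bij_betw_nth) (use assms in auto)
  have "boundary_ket k \<sigma> \<rho> =
      (\<Sum>j\<in>{0..k}. vertex_sign \<sigma> (?xs ! j) * ket (\<sigma> - {?xs ! j}) \<rho>)"
    unfolding boundary_ket_def vertex_sign_def
    using assms by (intro sum.cong) (simp_all add: card_less_nth_sorted_list_of_set)
  also have "\<dots> = (\<Sum>x\<in>\<sigma>. vertex_sign \<sigma> x * ket (\<sigma> - {x}) \<rho>)"
    by (rule sum.reindex_bij_betw[OF bij])
  finally show ?thesis .
qed

lemma boundary_ket_face:
  assumes "finite \<sigma>" and "card \<sigma> = k + 1" and "x \<in> \<sigma>"
  shows "boundary_ket k \<sigma> (\<sigma> - {x}) = vertex_sign \<sigma> x"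
proof -
  have "boundary_ket k \<sigma> (\<sigma> - {x}) = (\<Sum>y\<in>\<sigma>. if y = x then vertex_sign \<sigma> y else 0)"
    unfolding boundary_ket_eq_sum_vertices[OF assms(1,2)] ket_def
    using assms(3) by (intro sum.cong) auto
  then show ?thesis using assms by simp
qed

lemma boundary_ket_nonface:
  assumes "finite \<sigma>" and "card \<sigma> = k + 1" and "\<And>x. x \<in> \<sigma> \<Longrightarrow> \<rho> \<noteq> \<sigma> - {x}"
  shows "boundary_ket k \<sigma> \<rho> = 0"
  unfolding boundary_ket_eq_sum_vertices[OF assms(1,2)] ket_def
  using assms(3) by (intro sum.neutral) auto

text \<open>Exactly one of the four signs flips. If u < v, inserting v leaves the number of vertices
  below u unchanged, while inserting u raises the number below v by one. This is the cancellation
  behind the vanishing of the composite of two boundary maps.\<close>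

lemma vertex_sign_exchange:
  assumes "finite \<rho>" and "u \<notin> \<rho>" and "v \<notin> \<rho>" and "u \<noteq> v"
  shows "vertex_sign (insert v \<rho>) v * vertex_sign (insert u \<rho>) u +
    vertex_sign (insert u (insert v \<rho>)) v * vertex_sign (insert u (insert v \<rho>)) u = 0"
proof -
  have *: "vertex_sign (insert b \<rho>) b * vertex_sign (insert a \<rho>) a +
      vertex_sign (insert a (insert b \<rho>)) b * vertex_sign (insert a (insert b \<rho>)) a = 0"
    if "a \<notin> \<rho>" "b \<notin> \<rho>" "a < b" for a b
  proof -
    have "{y \<in> insert a (insert b \<rho>). y < a} = {y \<in> \<rho>. y < a}"
      "{y \<in> insert a (insert b \<rho>). y < b} = insert a {y \<in> \<rho>. y < b}"
      "{y \<in> insert a \<rho>. y < a} = {y \<in> \<rho>. y < a}"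
      "{y \<in> insert b \<rho>. y < b} = {y \<in> \<rho>. y < b}"
      using that by auto
    then show ?thesis using assms(1) that by (simp add: vertex_sign_def)
  qed
  show ?thesis
  proof (cases "u < v")
    case True
    then show ?thesis using * assms by blast
  next
    case False
    then have "v < u" using assms(4) by auto
    then show ?thesis
      using *[of v u] assms by (simp add: insert_commute mult.commute)
  qed
qed

lemma exchange_vertices:
  assumes "finite \<sigma>" and "finite \<tau>"
    and "card \<sigma> = k + 1" and "card \<tau> = k + 1" and "card (\<sigma> \<inter> \<tau>) = k"
  obtains u v where "u \<notin> \<tau>" and "v \<notin> \<sigma>"
    and "\<sigma> = insert u (\<sigma> \<inter> \<tau>)" and "\<tau> = insert v (\<sigma> \<inter> \<tau>)"
proof -
  have "card (\<sigma> - \<tau>) = 1" "card (\<tau> - \<sigma>) = 1"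
    using assms by (simp_all add: card_Diff_subset_Int Int_commute)
  then obtain u v where "\<sigma> - \<tau> = {u}" "\<tau> - \<sigma> = {v}"
    by (meson card_1_singletonE)
  then show thesis by (intro that[of u v]) auto
qed

section \<open>Entries of the Laplacian matrix\<close>

context
  fixes V :: "'a::linorder set" and \<Gamma> :: "'a set set"
  assumes complex: "simplicial_complex V \<Gamma>"
begin

lemma finite_simplices: "finite (simplices \<Gamma> k)"
  using complex unfolding simplicial_complex_def simplices_def
  by (auto intro: finite_subset[of _ "Pow V"])

lemma simplicesD:
  assumes "\<sigma> \<in> simplices \<Gamma> k"
  shows "finite \<sigma>" and "card \<sigma> = k + 1" and "\<sigma> \<subseteq> V" and "\<sigma> \<in> \<Gamma>"
  using assms complex unfolding simplicial_complex_def simplices_def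
  by (auto intro: finite_subset)

lemma face_in_complex:
  assumes "\<sigma> \<in> \<Gamma>" and "\<tau> \<subseteq> \<sigma>"
  shows "\<tau> \<in> \<Gamma>"
  using assms complex unfolding simplicial_complex_def by blast

text \<open>The first sum pairs two columns of the matrix of \<open>boundary \<Gamma> k\<close>,
  over common faces. The second pairs two rows of the next boundary matrix, over common
  cofaces.\<close>

lemma laplacian_mat_eq:
  assumes "\<sigma> \<in> simplices \<Gamma> k" and "\<tau> \<in> simplices \<Gamma> k"
  shows "laplacian_mat \<Gamma> k \<tau> \<sigma> =
    (\<Sum>\<rho>\<in>simplices \<Gamma> (k - 1). cnj (boundary_ket k \<tau> \<rho>) * boundary_ket k \<sigma> \<rho>) +
    (\<Sum>\<omega>\<in>simplices \<Gamma> (k + 1). cnj (boundary_ket (k + 1) \<omega> \<sigma>) * boundary_ket (k + 1) \<omega> \<tau>)"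
proof -
  \<comment> \<open>Applied to a basis vector, the adjoint reads off one row of the boundary matrix,
    since \<open>ket \<sigma>\<close> annihilates all other summands.\<close>
  have "coboundary \<Gamma> (k + 1) (ket \<sigma>) \<omega> = cnj (boundary_ket (k + 1) \<omega> \<sigma>)"
    if "\<omega> \<in> simplices \<Gamma> (k + 1)" for \<omega>
  proof -
    have "coboundary \<Gamma> (k + 1) (ket \<sigma>) \<omega> = (\<Sum>\<rho>\<in>simplices \<Gamma> k.
        if \<rho> = \<sigma> then cnj (boundary_ket (k + 1) \<omega> \<rho>) else 0)"
      unfolding coboundary_def adjoint_on_def boundary_ket_basis[OF finite_simplices that]
      using that by (auto simp: ket_def intro!: sum.cong)
    then show ?thesis using assms(1) by (simp add: finite_simplices)
  qed
  then have "boundary \<Gamma> (k + 1) (coboundary \<Gamma> (k + 1) (ket \<sigma>)) \<tau> =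
      (\<Sum>\<omega>\<in>simplices \<Gamma> (k + 1). cnj (boundary_ket (k + 1) \<omega> \<sigma>) * boundary_ket (k + 1) \<omega> \<tau>)"
    unfolding boundary_def by (intro sum.cong) simp_all
  then show ?thesis
    using assms unfolding laplacian_mat_def laplacian_def
    by (simp add: coboundary_def[of _ k] adjoint_on_def boundary_ket_basis finite_simplices)
qed

text \<open>The k + 1 facets of \<sigma> are distinct, and each contributes the square of a
  sign.\<close>

lemma sum_down_diag:
  assumes "\<sigma> \<in> simplices \<Gamma> k" and "k \<ge> 1"
  shows "(\<Sum>\<rho>\<in>simplices \<Gamma> (k - 1). cnj (boundary_ket k \<sigma> \<rho>) * boundary_ket k \<sigma> \<rho>) = of_nat (k + 1)"
proof -
  note \<sigma> = simplicesD[OF assms(1)]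
  let ?F = "(\<lambda>x. \<sigma> - {x}) ` \<sigma>"
  have inj: "inj_on (\<lambda>x. \<sigma> - {x}) \<sigma>" by (auto simp: inj_on_def)
  \<comment> \<open>The facets have k elements; with truncated subtraction, k = (k - 1) + 1 requires
    k \<ge> 1.\<close>
  have sub: "?F \<subseteq> simplices \<Gamma> (k - 1)"
    using \<sigma> assms(2) face_in_complex[of \<sigma>] by (auto simp: simplices_def)
  have "(\<Sum>\<rho>\<in>simplices \<Gamma> (k - 1). cnj (boundary_ket k \<sigma> \<rho>) * boundary_ket k \<sigma> \<rho>) =
      (\<Sum>\<rho>\<in>?F. cnj (boundary_ket k \<sigma> \<rho>) * boundary_ket k \<sigma> \<rho>)"
    by (rule sum.mono_neutral_right[OF finite_simplices sub])
      (use boundary_ket_nonface[OF \<sigma>(1,2)] in auto)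
  also have "\<dots> = (\<Sum>x\<in>\<sigma>. 1)"
    by (subst sum.reindex[OF inj]) (simp add: boundary_ket_face[OF \<sigma>(1,2)])
  finally show ?thesis using \<sigma>(2) by simp
qed

text \<open>Each coface of \<sigma> contributes the square of a sign and every other simplex
  contributes 0, so the sum counts cofaces.\<close>

lemma sum_up_diag:
  assumes "\<sigma> \<in> simplices \<Gamma> k"
  shows "(\<Sum>\<omega>\<in>simplices \<Gamma> (k + 1). cnj (boundary_ket (k + 1) \<omega> \<sigma>) * boundary_ket (k + 1) \<omega> \<sigma>) =
    of_nat (up_degree \<Gamma> k \<sigma>)"
proof -
  note \<sigma> = simplicesD[OF assms]
  have "cnj (boundary_ket (k + 1) \<omega> \<sigma>) * boundary_ket (k + 1) \<omega> \<sigma> = (if \<sigma> \<subseteq> \<omega> then 1 else 0)"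
    if "\<omega> \<in> simplices \<Gamma> (k + 1)" for \<omega>
  proof (cases "\<sigma> \<subseteq> \<omega>")
    case True
    note \<omega> = simplicesD[OF that]
    have "card (\<omega> - \<sigma>) = 1" using True \<sigma> \<omega> by (simp add: card_Diff_subset)
    then obtain x where "\<omega> - \<sigma> = {x}" by (meson card_1_singletonE)
    then have "x \<in> \<omega>" "\<sigma> = \<omega> - {x}" using True by auto
    then show ?thesis using boundary_ket_face[OF \<omega>(1,2)] by simp
  next
    case False
    then have "boundary_ket (k + 1) \<omega> \<sigma> = 0"
      using simplicesD[OF that] by (intro boundary_ket_nonface) auto
    then show ?thesis using False by simp
  qed
  then show ?thesis
    by (simp add: up_degree_def finite_simplices sum.If_cases Int_def)
qed

lemma laplacian_mat_diag:
  assumes "\<sigma> \<in> simplices \<Gamma> k" and "k \<ge> 1"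
  shows "laplacian_mat \<Gamma> k \<sigma> \<sigma> = of_nat (k + 1 + up_degree \<Gamma> k \<sigma>)"
  using laplacian_mat_eq[OF assms(1,1)] sum_down_diag[OF assms] sum_up_diag[OF assms(1)] by simp

text \<open>A common facet would be a k-element subset of the intersection, and a common coface
  would place the union inside a set of size k + 2. An intersection of size below k excludes
  both.\<close>

lemma laplacian_mat_far:
  assumes "\<sigma> \<in> simplices \<Gamma> k" and "\<tau> \<in> simplices \<Gamma> k"
    and "\<sigma> \<noteq> \<tau>" and "card (\<sigma> \<inter> \<tau>) \<noteq> k"
  shows "laplacian_mat \<Gamma> k \<tau> \<sigma> = 0"
proof -
  note \<sigma> = simplicesD[OF assms(1)] and \<tau> = simplicesD[OF assms(2)]
  \<comment> \<open>Two distinct sets of the same finite size cannot contain one another.\<close>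
  have "card (\<sigma> \<inter> \<tau>) < k + 1"
    using \<sigma> \<tau> assms(3)
    by (metis card_subset_eq inf.cobounded1 inf_le2 psubsetI psubset_card_mono)
  then have small: "card (\<sigma> \<inter> \<tau>) < k" using assms(4) by simp
  have "cnj (boundary_ket k \<tau> \<rho>) * boundary_ket k \<sigma> \<rho> = 0" for \<rho>
  proof (rule ccontr)
    assume "\<not> ?thesis"
    then have "boundary_ket k \<tau> \<rho> \<noteq> 0" "boundary_ket k \<sigma> \<rho> \<noteq> 0" by auto
    then obtain x y where xy: "x \<in> \<sigma>" "\<rho> = \<sigma> - {x}" "y \<in> \<tau>" "\<rho> = \<tau> - {y}"
      using boundary_ket_nonface \<sigma>(1,2) \<tau>(1,2) by metis
    then have "card \<rho> = k" "\<rho> \<subseteq> \<sigma> \<inter> \<tau>" using \<sigma> by auto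
    then show False using small \<sigma>(1) card_mono[of "\<sigma> \<inter> \<tau>" \<rho>] by auto
  qed
  moreover have "cnj (boundary_ket (k + 1) \<omega> \<sigma>) * boundary_ket (k + 1) \<omega> \<tau> = 0"
    if "\<omega> \<in> simplices \<Gamma> (k + 1)" for \<omega>
  proof (rule ccontr)
    note \<omega> = simplicesD[OF that]
    assume "\<not> ?thesis"
    then have "boundary_ket (k + 1) \<omega> \<tau> \<noteq> 0" "boundary_ket (k + 1) \<omega> \<sigma> \<noteq> 0" by auto
    then obtain x y where "\<sigma> = \<omega> - {x}" "\<tau> = \<omega> - {y}"
      using boundary_ket_nonface \<omega>(1,2) by metis
    then have "card (\<sigma> \<union> \<tau>) \<le> k + 2" using \<omega> card_mono[of \<omega> "\<sigma> \<union> \<tau>"] by auto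
    then show False using card_Un_Int[OF \<sigma>(1) \<tau>(1)] \<sigma>(2) \<tau>(2) small by simp
  qed
  ultimately show ?thesis
    unfolding laplacian_mat_eq[OF assms(1,2)] by (simp only: sum.neutral_const add_0 cong: sum.cong)
qed

text \<open>Each of the two sums has at most one nonzero term: \<rho> is the only common facet, and
  the union of the two simplices is the only candidate for a common coface. If it is a simplex,
  \<open>vertex_sign_exchange\<close> cancels the two terms.\<close>

lemma laplacian_mat_near:
  assumes "k \<ge> 1" and "insert u \<rho> \<in> simplices \<Gamma> k" and "insert v \<rho> \<in> simplices \<Gamma> k"
    and "u \<notin> \<rho>" and "v \<notin> \<rho>" and "u \<noteq> v"
  shows "laplacian_mat \<Gamma> k (insert v \<rho>) (insert u \<rho>) =
    (if insert u (insert v \<rho>) \<in> \<Gamma> then 0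
     else vertex_sign (insert v \<rho>) v * vertex_sign (insert u \<rho>) u)"
proof -
  let ?\<sigma> = "insert u \<rho>" and ?\<tau> = "insert v \<rho>" and ?\<omega> = "insert u (insert v \<rho>)"
  note \<sigma> = simplicesD[OF assms(2)] and \<tau> = simplicesD[OF assms(3)]
  have fin: "finite \<rho>" and card: "card \<rho> = k" using \<sigma> assms(4) by auto
  have \<rho>: "\<rho> \<in> simplices \<Gamma> (k - 1)"
    using face_in_complex[OF \<sigma>(4)] card assms(1) by (auto simp: simplices_def)
  have "?\<sigma> - {u} = \<rho>" "?\<tau> - {v} = \<rho>" using assms by auto
  then have bk_\<rho>: "boundary_ket k ?\<sigma> \<rho> = vertex_sign ?\<sigma> u"
    "boundary_ket k ?\<tau> \<rho> = vertex_sign ?\<tau> v"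
    using boundary_ket_face[OF \<sigma>(1,2), of u] boundary_ket_face[OF \<tau>(1,2), of v] by auto
  have "cnj (boundary_ket k ?\<tau> \<rho>') * boundary_ket k ?\<sigma> \<rho>' = 0"
    if "\<rho>' \<noteq> \<rho>" for \<rho>'
  proof (rule ccontr)
    assume "\<not> ?thesis"
    then have "boundary_ket k ?\<tau> \<rho>' \<noteq> 0" "boundary_ket k ?\<sigma> \<rho>' \<noteq> 0" by auto
    then obtain x y where "x \<in> ?\<sigma>" "\<rho>' = ?\<sigma> - {x}" "y \<in> ?\<tau>" "\<rho>' = ?\<tau> - {y}"
      using boundary_ket_nonface \<sigma>(1,2) \<tau>(1,2) by metis
    then show False using that assms by blast
  qed
  then have "(\<Sum>\<rho>\<in>simplices \<Gamma> (k - 1). cnj (boundary_ket k ?\<tau> \<rho>) * boundary_ket k ?\<sigma> \<rho>) =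
      (\<Sum>\<rho>'\<in>{\<rho>}. cnj (boundary_ket k ?\<tau> \<rho>') * boundary_ket k ?\<sigma> \<rho>')"
    using \<rho> by (intro sum.mono_neutral_right finite_simplices) auto
  then have down: "(\<Sum>\<rho>\<in>simplices \<Gamma> (k - 1). cnj (boundary_ket k ?\<tau> \<rho>) * boundary_ket k ?\<sigma> \<rho>) =
      vertex_sign ?\<tau> v * vertex_sign ?\<sigma> u"
    using bk_\<rho> by simp
  have zero: "cnj (boundary_ket (k + 1) \<omega> ?\<sigma>) * boundary_ket (k + 1) \<omega> ?\<tau> = 0"
    if "\<omega> \<in> simplices \<Gamma> (k + 1)" "\<omega> \<noteq> ?\<omega>" for \<omega>
  proof (rule ccontr)
    note \<omega> = simplicesD[OF that(1)]
    assume "\<not> ?thesis"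
    then have "boundary_ket (k + 1) \<omega> ?\<tau> \<noteq> 0" "boundary_ket (k + 1) \<omega> ?\<sigma> \<noteq> 0" by auto
    then obtain x y where "?\<sigma> = \<omega> - {x}" "?\<tau> = \<omega> - {y}"
      using boundary_ket_nonface \<omega>(1,2) by metis
    \<comment> \<open>A common coface contains the union; both have k + 2 elements, so they
      coincide.\<close>
    then have "?\<omega> \<subseteq> \<omega>" by auto
    moreover have "card ?\<omega> = card \<omega>" using \<omega>(2) card fin assms by simp
    ultimately show False using that(2) \<omega>(1) card_subset_eq by metis
  qed
  show ?thesis
  proof (cases "?\<omega> \<in> \<Gamma>")
    case True
    then have \<omega>: "?\<omega> \<in> simplices \<Gamma> (k + 1)"
      using card fin assms by (simp add: simplices_def)
    have "?\<omega> - {u} = ?\<tau>" "?\<omega> - {v} = ?\<sigma>" using assms by auto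
    then have bk: "boundary_ket (k + 1) ?\<omega> ?\<tau> = vertex_sign ?\<omega> u"
      "boundary_ket (k + 1) ?\<omega> ?\<sigma> = vertex_sign ?\<omega> v"
      using boundary_ket_face[OF simplicesD(1,2)[OF \<omega>], of u]
        boundary_ket_face[OF simplicesD(1,2)[OF \<omega>], of v] by auto
    have "(\<Sum>\<omega>\<in>simplices \<Gamma> (k + 1). cnj (boundary_ket (k + 1) \<omega> ?\<sigma>) * boundary_ket (k + 1) \<omega> ?\<tau>) =
        (\<Sum>\<omega>\<in>{?\<omega>}. cnj (boundary_ket (k + 1) \<omega> ?\<sigma>) * boundary_ket (k + 1) \<omega> ?\<tau>)"
      using \<omega> zero by (intro sum.mono_neutral_right finite_simplices) auto
    also have "\<dots> = vertex_sign ?\<omega> v * vertex_sign ?\<omega> u" using bk by simp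
    finally show ?thesis
      using laplacian_mat_eq[OF assms(2,3)] down True
        vertex_sign_exchange[OF fin assms(4-6)] by simp
  next
    case False
    then have "\<omega> \<noteq> ?\<omega>" if "\<omega> \<in> simplices \<Gamma> (k + 1)" for \<omega>
      using simplicesD[OF that] by auto
    then have "(\<Sum>\<omega>\<in>simplices \<Gamma> (k + 1).
        cnj (boundary_ket (k + 1) \<omega> ?\<sigma>) * boundary_ket (k + 1) \<omega> ?\<tau>) = 0"
      using zero by (intro sum.neutral) blast
    then show ?thesis using laplacian_mat_eq[OF assms(2,3)] down False by simp
  qed
qed

lemma cmod_laplacian_mat_off_diag:
  assumes "k \<ge> 1" and "\<sigma> \<in> simplices \<Gamma> k" and "\<tau> \<in> simplices \<Gamma> k" and "\<sigma> \<noteq> \<tau>"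
  shows "cmod (laplacian_mat \<Gamma> k \<tau> \<sigma>) = (if simplex_adj \<Gamma> k \<sigma> \<tau> then 1 else 0)"
proof (cases "card (\<sigma> \<inter> \<tau>) = k")
  case True
  note \<sigma> = simplicesD[OF assms(2)] and \<tau> = simplicesD[OF assms(3)]
  from exchange_vertices[OF \<sigma>(1) \<tau>(1) \<sigma>(2) \<tau>(2) True]
  obtain u v where uv: "u \<notin> \<tau>" "v \<notin> \<sigma>"
    "\<sigma> = insert u (\<sigma> \<inter> \<tau>)" "\<tau> = insert v (\<sigma> \<inter> \<tau>)" .
  have un: "insert u \<tau> = \<sigma> \<union> \<tau>" using uv by blast
  have neq: "u \<noteq> v" using uv by blast
  have "laplacian_mat \<Gamma> k \<tau> \<sigma> = (if \<sigma> \<union> \<tau> \<in> \<Gamma> then 0 else vertex_sign \<tau> v * vertex_sign \<sigma> u)"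
    using laplacian_mat_near[OF assms(1), of u "\<sigma> \<inter> \<tau>" v] uv(1,2) assms(2,3) neq
    unfolding uv(3,4)[symmetric] un by simp
  then show ?thesis
    using True assms by (simp add: simplex_adj_def norm_mult)
next
  case False
  then show ?thesis
    using laplacian_mat_far[OF assms(2-4)] by (simp add: simplex_adj_def)
qed

section \<open>Moduli of the entries of H and column norms\<close>

text \<open>Every coface adds one vertex of V - \<sigma>. The bound makes the diagonal of H
  nonnegative, and it also shows that the existence of a k-simplex forces n \<ge> k + 1.\<close>

lemma up_degree_le:
  assumes "\<sigma> \<in> simplices \<Gamma> k"
  shows "up_degree \<Gamma> k \<sigma> + k + 1 \<le> card V"
proof -
  note \<sigma> = simplicesD[OF assms]
  have finV: "finite V" using complex by (simp add: simplicial_complex_def)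
  have "{\<omega> \<in> simplices \<Gamma> (k + 1). \<sigma> \<subseteq> \<omega>} \<subseteq> (\<lambda>x. insert x \<sigma>) ` (V - \<sigma>)"
  proof
    fix \<omega> assume "\<omega> \<in> {\<omega> \<in> simplices \<Gamma> (k + 1). \<sigma> \<subseteq> \<omega>}"
    then have \<omega>: "\<omega> \<in> simplices \<Gamma> (k + 1)" "\<sigma> \<subseteq> \<omega>" by auto
    have "card (\<omega> - \<sigma>) = 1"
      using \<omega>(2) \<sigma> simplicesD[OF \<omega>(1)] by (simp add: card_Diff_subset)
    then obtain x where "\<omega> - \<sigma> = {x}" by (meson card_1_singletonE)
    then show "\<omega> \<in> (\<lambda>x. insert x \<sigma>) ` (V - \<sigma>)"
      using \<omega>(2) simplicesD(3)[OF \<omega>(1)] by blast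
  qed
  then have "up_degree \<Gamma> k \<sigma> \<le> card (V - \<sigma>)"
    unfolding up_degree_def using finV by (meson surj_card_le finite_Diff)
  moreover have "card (V - \<sigma>) + (k + 1) = card V"
    using \<sigma> finV card_mono[OF finV \<sigma>(3)] by (simp add: card_Diff_subset)
  ultimately show ?thesis by simp
qed

lemma cmod_H_mat:
  assumes "card V = n" and "k \<ge> 1" and "\<sigma> \<in> simplices \<Gamma> k" and "\<tau> \<in> simplices \<Gamma> k"
  shows "cmod (H_mat n \<Gamma> k \<tau> \<sigma>) =
    (if \<tau> = \<sigma> then (real n - real (up_degree \<Gamma> k \<sigma>) - real k - 1) / real n
     else if simplex_adj \<Gamma> k \<sigma> \<tau> then 1 / real n else 0)"
proof (cases "\<tau> = \<sigma>")
  case True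
  have le: "up_degree \<Gamma> k \<sigma> + k + 1 \<le> n" using up_degree_le[OF assms(3)] assms(1) by simp
  have "H_mat n \<Gamma> k \<sigma> \<sigma> =
      complex_of_real ((real n - real (up_degree \<Gamma> k \<sigma>) - real k - 1) / real n)"
    using le by (simp add: H_mat_def laplacian_mat_diag[OF assms(3,2)] field_simps)
  \<comment> \<open>Nonnegativity is what lets the modulus of the diagonal entry be dropped.\<close>
  moreover have "real n - real (up_degree \<Gamma> k \<sigma>) - real k - 1 \<ge> 0"
    using le by linarith
  ultimately show ?thesis using True by (simp del: of_real_divide of_real_diff)
next
  case False
  then show ?thesis
    using cmod_laplacian_mat_off_diag[OF assms(2-4)]
    by (auto simp: H_mat_def norm_mult norm_divide)
qed

lemma H_col_norm_eq:
  assumes "card V = n" and "k \<ge> 1" and "\<sigma> \<in> simplices \<Gamma> k"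
  shows "H_col_norm n \<Gamma> k \<sigma> =
    (real n + real (simplex_degree \<Gamma> k \<sigma>) - real (up_degree \<Gamma> k \<sigma>) - real k - 1) / real n"
proof -
  let ?S = "simplices \<Gamma> k"
  let ?N = "{\<tau> \<in> ?S. simplex_adj \<Gamma> k \<sigma> \<tau>}"
  \<comment> \<open>Off the diagonal only the neighbours of \<sigma> survive, each with weight
    1/n.\<close>
  have "(\<Sum>\<tau>\<in>?S - {\<sigma>}. cmod (H_mat n \<Gamma> k \<tau> \<sigma>)) = (\<Sum>\<tau>\<in>?N. 1 / real n)"
    by (rule sum.mono_neutral_cong_right)
      (use cmod_H_mat[OF assms] finite_simplices in \<open>auto simp: simplex_adj_def\<close>)
  then have "H_col_norm n \<Gamma> k \<sigma> =
      (real n - real (up_degree \<Gamma> k \<sigma>) - real k - 1) / real n + real (simplex_degree \<Gamma> k \<sigma>) / real n"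
    unfolding H_col_norm_def sum.remove[OF finite_simplices assms(3)]
    using cmod_H_mat[OF assms assms(3)] by (simp add: simplex_degree_def)
  then show ?thesis by (simp flip: add_divide_distrib)
qed

section \<open>Degree bounds for the simplex graph\<close>

text \<open>A neighbour arises by swapping one vertex u of \<sigma> for an outside vertex v. The
  last conclusion restates that the union is not a simplex, which is what the clique case
  exploits.\<close>

lemma simplex_adj_exchange:
  assumes "simplex_adj \<Gamma> k \<sigma> \<tau>"
  obtains u v where "u \<in> \<sigma>" and "v \<in> V - \<sigma>" and "\<tau> = insert v (\<sigma> - {u})"
    and "insert v \<sigma> \<notin> \<Gamma>"
proof -
  have in_S: "\<sigma> \<in> simplices \<Gamma> k" "\<tau> \<in> simplices \<Gamma> k" and card: "card (\<sigma> \<inter> \<tau>) = k"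
    and un: "\<sigma> \<union> \<tau> \<notin> \<Gamma>"
    using assms by (auto simp: simplex_adj_def)
  note \<sigma> = simplicesD[OF in_S(1)] and \<tau> = simplicesD[OF in_S(2)]
  from exchange_vertices[OF \<sigma>(1) \<tau>(1) \<sigma>(2) \<tau>(2) card]
  obtain u v where uv: "u \<notin> \<tau>" "v \<notin> \<sigma>"
    "\<sigma> = insert u (\<sigma> \<inter> \<tau>)" "\<tau> = insert v (\<sigma> \<inter> \<tau>)" .
  have "insert v \<sigma> = \<sigma> \<union> \<tau>" using uv by blast
  moreover have "u \<in> \<sigma>" "v \<in> \<tau>" "\<sigma> - {u} = \<sigma> \<inter> \<tau>" using uv by blast+
  ultimately show thesis using uv(2,4) un \<tau>(3) by (intro that[of u v]) auto
qed

text \<open>The swaps are indexed by pairs from (V - \<sigma>) \<times> \<sigma>, so their number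
  bounds the degree.\<close>

lemma simplex_degree_le:
  assumes "\<sigma> \<in> simplices \<Gamma> k"
  shows "simplex_degree \<Gamma> k \<sigma> \<le> (card V - (k + 1)) * (k + 1)"
proof -
  note \<sigma> = simplicesD[OF assms]
  have finV: "finite V" using complex by (simp add: simplicial_complex_def)
  have "{\<tau> \<in> simplices \<Gamma> k. simplex_adj \<Gamma> k \<sigma> \<tau>} \<subseteq>
      (\<lambda>(v, u). insert v (\<sigma> - {u})) ` ((V - \<sigma>) \<times> \<sigma>)"
    by (auto elim!: simplex_adj_exchange)
  then have "simplex_degree \<Gamma> k \<sigma> \<le> card ((V - \<sigma>) \<times> \<sigma>)"
    unfolding simplex_degree_def using finV \<sigma>(1)
    by (intro surj_card_le finite_cartesian_product) auto
  then show ?thesis using \<sigma> by (simp add: card_cartesian_product card_Diff_subset)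
qed

lemma simplex_degree_clique_complex_le:
  assumes "\<Gamma> = clique_complex W E" and "\<sigma> \<in> simplices \<Gamma> k"
  shows "simplex_degree \<Gamma> k \<sigma> \<le> card V - (k + 1)"
proof -
  note \<sigma> = simplicesD[OF assms(2)]
  have finV: "finite V" using complex by (simp add: simplicial_complex_def)
  \<comment> \<open>Deleting all vertices of \<sigma> not joined to v makes f a function of v alone;
    for a v coming from a neighbour, exactly one vertex is deleted.\<close>
  define f where "f v = insert v (\<sigma> - {u \<in> \<sigma>. {u, v} \<notin> E})" for v
  have "{\<tau> \<in> simplices \<Gamma> k. simplex_adj \<Gamma> k \<sigma> \<tau>} \<subseteq> f ` (V - \<sigma>)"
  proof
    fix \<tau> assume "\<tau> \<in> {\<tau> \<in> simplices \<Gamma> k. simplex_adj \<Gamma> k \<sigma> \<tau>}"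
    then have \<tau>: "\<tau> \<in> simplices \<Gamma> k" "simplex_adj \<Gamma> k \<sigma> \<tau>" by auto
    from simplex_adj_exchange[OF \<tau>(2)]
    obtain u v where uv: "u \<in> \<sigma>" "v \<in> V - \<sigma>" "\<tau> = insert v (\<sigma> - {u})" "insert v \<sigma> \<notin> \<Gamma>" .
    have cl\<tau>: "\<tau> \<subseteq> W" "clique \<tau> E" and cl\<sigma>: "\<sigma> \<subseteq> W" "clique \<sigma> E"
      using simplicesD(4)[OF \<tau>(1)] \<sigma>(4) by (auto simp: assms(1) clique_complex_def)
    have joined: "{w, v} \<in> E" if "w \<in> \<sigma>" "w \<noteq> u" for w
      using cl\<tau>(2) uv that by (auto simp: clique_def)
    \<comment> \<open>All other vertices of \<sigma> are joined to v inside the clique \<tau>. If u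
      were joined too, \<sigma> together with v would be a clique, hence a simplex.\<close>
    have "{u, v} \<notin> E"
    proof
      assume "{u, v} \<in> E"
      then have "{w, v} \<in> E" if "w \<in> \<sigma>" for w using joined that by blast
      then have "clique (insert v \<sigma>) E"
        using cl\<sigma>(2) by (auto simp: clique_def insert_commute)
      moreover have "insert v \<sigma> \<subseteq> W" using cl\<sigma>(1) cl\<tau>(1) uv(3) by auto
      ultimately show False using uv(4) by (simp add: assms(1) clique_complex_def)
    qed
    then have "{u \<in> \<sigma>. {u, v} \<notin> E} = {u}" using joined uv(1) by auto
    then show "\<tau> \<in> f ` (V - \<sigma>)" using uv by (auto simp: f_def)
  qed
  then have "simplex_degree \<Gamma> k \<sigma> \<le> card (V - \<sigma>)"
    unfolding simplex_degree_def using finV by (intro surj_card_le) auto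
  then show ?thesis using \<sigma> by (simp add: card_Diff_subset)
qed

text \<open>Nonemptiness matters because \<open>Max\<close> has no specified value on the empty
  set.\<close>

lemma max_simplex_degree_le:
  assumes "simplices \<Gamma> k \<noteq> {}" and "\<And>\<sigma>. \<sigma> \<in> simplices \<Gamma> k \<Longrightarrow> simplex_degree \<Gamma> k \<sigma> \<le> b"
  shows "max_simplex_degree \<Gamma> k \<le> b"
  unfolding max_simplex_degree_def using assms finite_simplices by (subst Max_le_iff) auto

end

section \<open>Column norms, transition probabilities and maximum degree\<close>

theorem theorem4:
  fixes V :: "'a::linorder set" and \<Gamma> :: "'a set set" and n k :: nat
  assumes "simplicial_complex V \<Gamma>" and "card V = n" and "k \<ge> 1"
  shows
    "(\<forall>\<sigma>\<in>simplices \<Gamma> k.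
        H_col_norm n \<Gamma> k \<sigma> =
          1 + 1 / real n *
            (real (simplex_degree \<Gamma> k \<sigma>) - real (up_degree \<Gamma> k \<sigma>) - real k - 1))
     \<and>
     (\<forall>\<sigma>\<in>simplices \<Gamma> k. \<forall>\<tau>\<in>simplices \<Gamma> k.
        transition_prob n \<Gamma> k \<sigma> \<tau> =
          (if simplex_adj \<Gamma> k \<sigma> \<tau> then
             1 / (real n + real (simplex_degree \<Gamma> k \<sigma>) - real (up_degree \<Gamma> k \<sigma>) - real k - 1)
           else if \<sigma> = \<tau> then
             (real n - real (up_degree \<Gamma> k \<sigma>) - real k - 1) /
             (real n + real (simplex_degree \<Gamma> k \<sigma>) - real (up_degree \<Gamma> k \<sigma>) - real k - 1)
           else 0))
     \<and>
     (simplices \<Gamma> k \<noteq> {} \<longrightarrow>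
        int (max_simplex_degree \<Gamma> k) \<le> (int n - int k - 1) * (int k + 1) \<and>
        ((\<exists>W E. simple_graph W E \<and> \<Gamma> = clique_complex W E) \<longrightarrow>
           int (max_simplex_degree \<Gamma> k) \<le> int n - int k - 1))"
proof (intro conjI ballI impI)
  fix \<sigma> assume \<sigma>: "\<sigma> \<in> simplices \<Gamma> k"
  have n: "real n > 0" using up_degree_le[OF assms(1) \<sigma>] assms(2) by simp
  show "H_col_norm n \<Gamma> k \<sigma> = 1 + 1 / real n *
      (real (simplex_degree \<Gamma> k \<sigma>) - real (up_degree \<Gamma> k \<sigma>) - real k - 1)"
    using n by (simp add: H_col_norm_eq[OF assms \<sigma>] field_simps)
  fix \<tau> assume \<tau>: "\<tau> \<in> simplices \<Gamma> k"
  \<comment> \<open>The statement tests adjacency first, whereas \<open>cmod_H_mat\<close> tests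
    equality first; the cases agree because adjacent simplices are distinct.\<close>
  have "\<sigma> \<noteq> \<tau>" if "simplex_adj \<Gamma> k \<sigma> \<tau>" using that by (simp add: simplex_adj_def)
  then show "transition_prob n \<Gamma> k \<sigma> \<tau> =
      (if simplex_adj \<Gamma> k \<sigma> \<tau> then
         1 / (real n + real (simplex_degree \<Gamma> k \<sigma>) - real (up_degree \<Gamma> k \<sigma>) - real k - 1)
       else if \<sigma> = \<tau> then
         (real n - real (up_degree \<Gamma> k \<sigma>) - real k - 1) /
         (real n + real (simplex_degree \<Gamma> k \<sigma>) - real (up_degree \<Gamma> k \<sigma>) - real k - 1)
       else 0)"
    \<comment> \<open>The common factor 1/n cancels. A column norm may be 0, namely when the degree
      is 0 and the up-degree is n - k - 1; both sides are then 0 because x / 0 = 0.\<close>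
    using n unfolding transition_prob_def cmod_H_mat[OF assms \<sigma> \<tau>] H_col_norm_eq[OF assms \<sigma>]
    by auto
next
  assume nonempty: "simplices \<Gamma> k \<noteq> {}"
  then obtain \<sigma> where "\<sigma> \<in> simplices \<Gamma> k" by blast
  then have "k + 1 \<le> n" using up_degree_le[OF assms(1)] assms(2) by fastforce
  \<comment> \<open>Since k + 1 \<le> n, truncated subtraction agrees with integer subtraction, so
    the bounds on naturals transfer.\<close>
  then have n: "int (n - (k + 1)) = int n - int k - 1" by simp
  have "max_simplex_degree \<Gamma> k \<le> (n - (k + 1)) * (k + 1)"
    using max_simplex_degree_le[OF assms(1) nonempty] simplex_degree_le[OF assms(1)] assms(2)
    by blast
  then have "int (max_simplex_degree \<Gamma> k) \<le> int (n - (k + 1)) * int (k + 1)"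
    by (simp only: zle_int flip: of_nat_mult)
  then show "int (max_simplex_degree \<Gamma> k) \<le> (int n - int k - 1) * (int k + 1)"
    unfolding n by (simp add: add.commute)
  assume "\<exists>W E. simple_graph W E \<and> \<Gamma> = clique_complex W E"
  then obtain W E where "\<Gamma> = clique_complex W E" by blast
  then have "max_simplex_degree \<Gamma> k \<le> n - (k + 1)"
    using max_simplex_degree_le[OF assms(1) nonempty]
      simplex_degree_clique_complex_le[OF assms(1)] assms(2) by blast
  then show "int (max_simplex_degree \<Gamma> k) \<le> int n - int k - 1"
    using n by linarith
qed

end
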